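(* If $A$ and $B$ are graph automatic groups, then their direct product $A\times B$ is graph automatic.
   Context: For a finite alphabet $\Sigma$, let $\Sigma^\star$ be the set of finite strings over $\Sigma$. For strings $w_1,\dots,w_n\in\Sigma^\star$ the convolution $\otimes(w_1,\dots,w_n)$ is the string of length $\max_i|w_i|$ over the alphabet $(\Sigma\cup\{\diamond\})^n$ (with $\diamond\notin\Sigma$) whose $k$-th symbol is $(\sigma_1,\dots,\sigma_n)$, where $\sigma_i$ is the $k$-th symbol of $w_i$ if $k\le|w_i|$ and $\sigma_i=\diamond$ otherwise. A relation $R\subseteq(\Sigma^\star)^n$ is FA recognizable if $\{\otimes(w_1,\dots,w_n)\mid (w_1,\dots,w_n)\in R\}$ is a regular language (recognized by a finite automaton). Let $G$ be a group generated by a finite set $X$. Its Cayley graph $\Gamma(G,X)$ is viewed as the structure $(G;(E_x)_{x\in X})$ with $E_x=\{(g,gx)\mid g\in G\}$. The group $G$ is graph automatic with respect to $X$ if there are a finite alphabet $\Sigma$, a regular language $R\subseteq\Sigma^\star$ and a bijection $\nu:R\to G$ such that for each $x\in X$ the relation $\{(u,v)\in R^2\mid \nu(u)x=\nu(v)\}$ is FA recognizable. A finitely generated group is graph automatic if it is graph automatic with respect to some finite generating set. *)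

theory Defs
  imports "HOL-Algebra.Generated_Groups"
begin

record ('s, 'a) dfa =
  states :: "'s set"
  init :: 's
  trans_fun :: "'s \<Rightarrow> 'a \<Rightarrow> 's"
  final :: "'s set"

definition dfa_over :: "'a set \<Rightarrow> ('s, 'a) dfa \<Rightarrow> bool" where
  "dfa_over \<Sigma> M \<longleftrightarrow>
     finite \<Sigma> \<and> finite (states M) \<and> init M \<in> states M \<and> final M \<subseteq> states M \<and>
     (\<forall>q\<in>states M. \<forall>a\<in>\<Sigma>. trans_fun M q a \<in> states M)"

definition dfa_language :: "'a set \<Rightarrow> ('s, 'a) dfa \<Rightarrow> 'a list set" where
  "dfa_language \<Sigma> M = {w \<in> lists \<Sigma>. foldl (trans_fun M) (init M) w \<in> final M}"

(* States are numbers only because a type cannot be quantified existentially;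
   regular_languageI admits an arbitrary state type. *)
definition regular_language :: "'a set \<Rightarrow> 'a list set \<Rightarrow> bool" where
  "regular_language \<Sigma> L \<longleftrightarrow> (\<exists>M :: (nat, 'a) dfa. dfa_over \<Sigma> M \<and> L = dfa_language \<Sigma> M)"

(* An n-tuple of strings is a list of length n, a letter of the convolution alphabet is a
   list of length n over the option type, and None is the padding symbol.
   Inserting 0 only gives the empty tuple the convolution []. *)
definition convolution :: "'a list list \<Rightarrow> 'a option list list" where
  "convolution ws =
     map (\<lambda>k. map (\<lambda>w. if k < length w then Some (w ! k) else None) ws)
       [0..<Max (insert 0 (length ` set ws))]"

definition padded_alphabet :: "nat \<Rightarrow> 'a set \<Rightarrow> 'a option list set" where
  "padded_alphabet n \<Sigma> = {s. length s = n \<and> set s \<subseteq> insert None (Some ` \<Sigma>)}"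

definition FA_recognizable :: "nat \<Rightarrow> 'a set \<Rightarrow> 'a list list set \<Rightarrow> bool" where
  "FA_recognizable n \<Sigma> R \<longleftrightarrow>
     R \<subseteq> {ws. length ws = n \<and> set ws \<subseteq> lists \<Sigma>} \<and>
     regular_language (padded_alphabet n \<Sigma>) (convolution ` R)"

definition cayley_edges :: "('g, 'm) monoid_scheme \<Rightarrow> 'g \<Rightarrow> ('g \<times> 'g) set" where
  "cayley_edges G x = {(g, g \<otimes>\<^bsub>G\<^esub> x) | g. g \<in> carrier G}"

definition FA_presentation ::
  "'a set \<Rightarrow> 'a list set \<Rightarrow> ('a list \<Rightarrow> 'g) \<Rightarrow> ('g, 'm) monoid_scheme \<Rightarrow> 'g set \<Rightarrow> bool" where
  "FA_presentation \<Sigma> R \<nu> G X \<longleftrightarrow>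
     finite \<Sigma> \<and> regular_language \<Sigma> R \<and> bij_betw \<nu> R (carrier G) \<and>
     (\<forall>x\<in>X. FA_recognizable 2 \<Sigma>
        {[u, v] | u v. u \<in> R \<and> v \<in> R \<and> (\<nu> u, \<nu> v) \<in> cayley_edges G x})"

(* Symbols are numbers only because a type cannot be quantified existentially;
   graph_automatic_wrtI admits finite alphabets over an arbitrary type. *)
definition graph_automatic_wrt :: "('g, 'm) monoid_scheme \<Rightarrow> 'g set \<Rightarrow> bool" where
  "graph_automatic_wrt G X \<longleftrightarrow>
     group G \<and> finite X \<and> X \<subseteq> carrier G \<and> generate G X = carrier G \<and>
     (\<exists>(\<Sigma> :: nat set) R \<nu>. FA_presentation \<Sigma> R \<nu> G X)"

definition graph_automatic :: "('g, 'm) monoid_scheme \<Rightarrow> bool" where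
  "graph_automatic G \<longleftrightarrow> (\<exists>X. graph_automatic_wrt G X)"

lemma regular_languageI:
  fixes M :: "('s, 'a) dfa"
  assumes M: "dfa_over \<Sigma> M"
  shows "regular_language \<Sigma> (dfa_language \<Sigma> M)"
proof -
  from M have fin: "finite (states M)" by (simp add: dfa_over_def)
  then obtain f :: "'s \<Rightarrow> nat" where f: "inj_on f (states M)"
    using finite_imp_inj_to_nat_seg by metis
  define g where "g = the_inv_into (states M) f"
  have gf: "g (f q) = q" if "q \<in> states M" for q
    using that f by (simp add: g_def the_inv_into_f_f)
  define N :: "(nat, 'a) dfa" where
    "N = \<lparr>states = f ` states M, init = f (init M),
          trans_fun = (\<lambda>q a. f (trans_fun M (g q) a)), final = f ` final M\<rparr>"
  have N: "dfa_over \<Sigma> N"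
    using M by (auto simp: dfa_over_def N_def gf)
  have run: "foldl (trans_fun N) (f q) w = f (foldl (trans_fun M) q w) \<and>
      foldl (trans_fun M) q w \<in> states M" if "q \<in> states M" "w \<in> lists \<Sigma>" for q w
    using that(2,1) M
    by (induction w arbitrary: q) (auto simp: N_def gf dfa_over_def)
  have "f q \<in> f ` final M \<longleftrightarrow> q \<in> final M" if "q \<in> states M" for q
    using that f M by (auto simp: dfa_over_def inj_on_def)
  moreover have "init M \<in> states M"
    using M by (simp add: dfa_over_def)
  moreover have "init N = f (init M)" "final N = f ` final M"
    by (simp_all add: N_def)
  ultimately have "dfa_language \<Sigma> N = dfa_language \<Sigma> M"
    using run[of "init M"] by (simp add: dfa_language_def cong: conj_cong)
  with N show ?thesis
    unfolding regular_language_def by metis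
qed

lemma regular_language_map:
  assumes L: "regular_language \<Sigma> L" and f: "inj_on f \<Sigma>"
  shows "regular_language (f ` \<Sigma>) (map f ` L)"
proof -
  from L obtain M :: "(nat, 'a) dfa" where M: "dfa_over \<Sigma> M" "L = dfa_language \<Sigma> M"
    unfolding regular_language_def by blast
  define g where "g = the_inv_into \<Sigma> f"
  have gf: "g (f a) = a" if "a \<in> \<Sigma>" for a
    using that f by (simp add: g_def the_inv_into_f_f)
  define N where "N = \<lparr>states = states M, init = init M,
    trans_fun = (\<lambda>q a. trans_fun M q (g a)), final = final M\<rparr>"
  have N: "dfa_over (f ` \<Sigma>) N"
    using M(1) by (auto simp: dfa_over_def N_def gf)
  have run: "foldl (trans_fun N) q (map f w) = foldl (trans_fun M) q w"
    if "w \<in> lists \<Sigma>" for q w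
    using that by (induction w arbitrary: q) (auto simp: N_def gf)
  have "dfa_language (f ` \<Sigma>) N = map f ` dfa_language \<Sigma> M"
  proof -
    have "init N = init M" "final N = final M"
      by (simp_all add: N_def)
    then have "map f w \<in> dfa_language (f ` \<Sigma>) N \<longleftrightarrow> w \<in> dfa_language \<Sigma> M"
      if "w \<in> lists \<Sigma>" for w
      using that run[OF that, of "init M"] by (auto simp: dfa_language_def)
    moreover have "dfa_language (f ` \<Sigma>) N \<subseteq> map f ` lists \<Sigma>"
      "dfa_language \<Sigma> M \<subseteq> lists \<Sigma>"
      unfolding lists_image[symmetric] dfa_language_def by blast+
    ultimately show ?thesis by blast
  qed
  with N M(2) show ?thesis
    unfolding regular_language_def by metis
qed

lemma convolution_map:
  "convolution (map (map f) ws) = map (map (map_option f)) (convolution ws)"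
proof -
  have "length ` set (map (map f) ws) = length ` set ws"
    by (auto simp: image_image)
  then show ?thesis
    unfolding convolution_def by (simp add: o_def if_distrib cong: if_cong)
qed

lemma FA_recognizable_map:
  assumes R: "FA_recognizable n \<Sigma> R" and f: "inj_on f \<Sigma>"
  shows "FA_recognizable n (f ` \<Sigma>) (map (map f) ` R)"
proof -
  let ?h = "map (map_option f)"
  have inj_opt: "inj_on (map_option f) (insert None (Some ` \<Sigma>))"
    using f by (auto simp: inj_on_def)
  have pad: "padded_alphabet n \<Gamma> = {s \<in> lists (insert None (Some ` \<Gamma>)). length s = n}"
    for \<Gamma> :: "'z set"
    by (auto simp: padded_alphabet_def)
  have "inj_on ?h (lists (insert None (Some ` \<Sigma>)))"
    using inj_opt by (rule inj_on_map_lists)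
  then have inj: "inj_on ?h (padded_alphabet n \<Sigma>)"
    by (rule inj_on_subset) (auto simp: pad)
  have "insert None (Some ` f ` \<Sigma>) = map_option f ` insert None (Some ` \<Sigma>)"
    by (auto simp: image_image)
  then have img: "?h ` padded_alphabet n \<Sigma> = padded_alphabet n (f ` \<Sigma>)"
    unfolding pad lists_image[symmetric] by (simp only: lists_image) (auto simp del: in_lists_conv_set)
  have "convolution ` map (map f) ` R = map ?h ` convolution ` R"
    by (simp add: image_image convolution_map)
  moreover have "regular_language (?h ` padded_alphabet n \<Sigma>) (map ?h ` convolution ` R)"
    using R inj by (intro regular_language_map) (auto simp: FA_recognizable_def)
  moreover have "map (map f) ` R \<subseteq> {ws. length ws = n \<and> set ws \<subseteq> lists (f ` \<Sigma>)}"
  proof (rule image_subsetI)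
    fix ws assume "ws \<in> R"
    with R have "length ws = n" "set ws \<subseteq> lists \<Sigma>"
      by (auto simp only: FA_recognizable_def)
    then show "map (map f) ws \<in> {ws. length ws = n \<and> set ws \<subseteq> lists (f ` \<Sigma>)}"
      unfolding lists_image by auto
  qed
  ultimately show ?thesis
    by (simp add: FA_recognizable_def img)
qed

lemma graph_automatic_wrtI:
  fixes \<Sigma> :: "'a set"
  assumes "group G" "finite X" "X \<subseteq> carrier G" "generate G X = carrier G"
    and P: "FA_presentation \<Sigma> R \<nu> G X"
  shows "graph_automatic_wrt G X"
proof -
  from P have fin: "finite \<Sigma>" and reg: "regular_language \<Sigma> R"
    and bij: "bij_betw \<nu> R (carrier G)"
    and rel: "\<And>x. x \<in> X \<Longrightarrow> FA_recognizable 2 \<Sigma>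
        {[u, v] | u v. u \<in> R \<and> v \<in> R \<and> (\<nu> u, \<nu> v) \<in> cayley_edges G x}"
    by (auto simp: FA_presentation_def)
  obtain f :: "'a \<Rightarrow> nat" where f: "inj_on f \<Sigma>"
    using finite_imp_inj_to_nat_seg[OF fin] by metis
  have "R \<subseteq> lists \<Sigma>"
    using reg by (auto simp: regular_language_def dfa_language_def)
  then have inj: "inj_on (map f) R"
    using f by (meson inj_on_map_lists inj_on_subset)
  define \<mu> where "\<mu> = \<nu> \<circ> the_inv_into R (map f)"
  have \<mu>: "\<mu> (map f u) = \<nu> u" if "u \<in> R" for u
    using that inj by (simp add: \<mu>_def the_inv_into_f_f)
  have "bij_betw \<mu> (map f ` R) (carrier G)"
    unfolding \<mu>_def
    using bij inj by (meson bij_betw_the_inv_into bij_betw_trans inj_on_imp_bij_betw)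
  moreover have "FA_recognizable 2 (f ` \<Sigma>)
      {[u, v] | u v. u \<in> map f ` R \<and> v \<in> map f ` R \<and> (\<mu> u, \<mu> v) \<in> cayley_edges G x}"
    if "x \<in> X" for x
  proof -
    have "{[u, v] | u v. u \<in> map f ` R \<and> v \<in> map f ` R \<and> (\<mu> u, \<mu> v) \<in> cayley_edges G x} =
      map (map f) ` {[u, v] | u v. u \<in> R \<and> v \<in> R \<and> (\<nu> u, \<nu> v) \<in> cayley_edges G x}"
      (is "?L = ?M")
    proof
      show "?L \<subseteq> ?M"
      proof
        fix z assume "z \<in> ?L"
        then obtain u v where "u \<in> R" "v \<in> R" "(\<mu> (map f u), \<mu> (map f v)) \<in> cayley_edges G x"
          "z = map (map f) [u, v]" by auto
        then show "z \<in> ?M" by (intro image_eqI[of _ _ "[u, v]"]) (auto simp: \<mu>)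
      qed
      show "?M \<subseteq> ?L" using \<mu> by fastforce
    qed
    with FA_recognizable_map[OF rel[OF that] f] show ?thesis by simp
  qed
  ultimately have "FA_presentation (f ` \<Sigma>) (map f ` R) \<mu> G X"
    using fin regular_language_map[OF reg f] by (simp add: FA_presentation_def)
  with assms(1-4) show ?thesis
    unfolding graph_automatic_wrt_def by blast
qed

end

theory Submission
  imports Defs
begin

text \<open>
  A pair of normal forms is written on two tracks of a single word. An edge of the product labelled
  (x, y) is then a pair of edges labelled x and y, so its convolution carries the convolutions of
  these two edges on its tracks, up to a letter-wise recoding. As both generating sets may be
  enlarged by the identity, whose edges form the diagonal, the product of the two generating sets
  generates the direct product.
\<close>

section \<open>Closure properties of regular languages\<close>

lemma regular_language_subset_lists: "regular_language \<Sigma> L \<Longrightarrow> L \<subseteq> lists \<Sigma>"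
  by (auto simp: regular_language_def dfa_language_def)

lemma regular_language_finite: "regular_language \<Sigma> L \<Longrightarrow> finite \<Sigma>"
  by (auto simp: regular_language_def dfa_over_def)

text \<open>The automaton reads \<open>f a\<close> whenever it is fed \<open>a\<close>. As
  \<open>f\<close> stays inside \<open>\<Sigma>\<close>, its states remain closed under
  transitions.\<close>

lemma regular_language_vimage:
  assumes L: "regular_language \<Sigma> L" and "finite \<Delta>" and f: "f ` \<Delta> \<subseteq> \<Sigma>"
  shows "regular_language \<Delta> {w \<in> lists \<Delta>. map f w \<in> L}"
proof -
  from L obtain M :: "(nat, 'a) dfa" where M: "dfa_over \<Sigma> M" "L = dfa_language \<Sigma> M"
    unfolding regular_language_def by blast
  define N where "N = \<lparr>states = states M, init = init M,
    trans_fun = (\<lambda>q a. trans_fun M q (f a)), final = final M\<rparr>"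
  have "dfa_over \<Delta> N"
    using M(1) assms by (auto simp: dfa_over_def N_def)
  moreover have "foldl (trans_fun N) q w = foldl (trans_fun M) q (map f w)" for q w
    by (induction w arbitrary: q) (auto simp: N_def)
  then have "dfa_language \<Delta> N = {w \<in> lists \<Delta>. map f w \<in> L}"
    using f by (auto simp: dfa_language_def M(2) N_def image_subset_iff)
  ultimately show ?thesis
    using regular_languageI by metis
qed

lemma regular_language_Int:
  assumes "regular_language \<Sigma> K" and "regular_language \<Sigma> L"
  shows "regular_language \<Sigma> (K \<inter> L)"
proof -
  from assms obtain M N :: "(nat, 'a) dfa" where M: "dfa_over \<Sigma> M" "K = dfa_language \<Sigma> M"
    and N: "dfa_over \<Sigma> N" "L = dfa_language \<Sigma> N"
    unfolding regular_language_def by blast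
  define P where "P = \<lparr>states = states M \<times> states N, init = (init M, init N),
    trans_fun = (\<lambda>(p, q) a. (trans_fun M p a, trans_fun N q a)), final = final M \<times> final N\<rparr>"
  have "dfa_over \<Sigma> P"
    using M(1) N(1) by (auto simp: dfa_over_def P_def)
  moreover have "foldl (trans_fun P) (p, q) w =
      (foldl (trans_fun M) p w, foldl (trans_fun N) q w)" for p q w
    by (induction w arbitrary: p q) (auto simp: P_def)
  then have "dfa_language \<Sigma> P = K \<inter> L"
    by (auto simp: dfa_language_def M(2) N(2) P_def)
  ultimately show ?thesis
    using regular_languageI by metis
qed

text \<open>\<open>dfa_over\<close> says nothing about transitions on letters outside
  \<open>\<Sigma>\<close>. Such letters lead to a sink, the state \<open>None\<close>.\<close>

lemma regular_language_mono:
  assumes L: "regular_language \<Sigma> L" and sub: "\<Sigma> \<subseteq> \<Delta>" and fin: "finite \<Delta>"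
  shows "regular_language \<Delta> L"
proof -
  from L obtain M :: "(nat, 'a) dfa" where M: "dfa_over \<Sigma> M" "L = dfa_language \<Sigma> M"
    unfolding regular_language_def by blast
  define N where "N = \<lparr>states = insert None (Some ` states M), init = Some (init M),
    trans_fun = (\<lambda>q a. if a \<in> \<Sigma> then map_option (\<lambda>q. trans_fun M q a) q else None),
    final = Some ` final M\<rparr>"
  have "dfa_over \<Delta> N"
    using M(1) fin by (auto simp: dfa_over_def N_def)
  moreover have "foldl (trans_fun N) None w = None" for w
    by (induction w) (auto simp: N_def)
  then have "foldl (trans_fun N) (Some q) w =
      (if w \<in> lists \<Sigma> then Some (foldl (trans_fun M) q w) else None)" for q w
    by (induction w arbitrary: q) (auto simp: N_def)
  then have "dfa_language \<Delta> N = L"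
    using sub by (auto simp: dfa_language_def M(2) N_def split: if_splits)
  ultimately show ?thesis
    using regular_languageI by metis
qed

text \<open>This is the inverse image under the identity, viewed as a letter map from
  \<open>\<Delta>\<close> to \<open>\<Sigma>\<close>.\<close>

lemma regular_language_restrict:
  assumes "regular_language \<Sigma> L" and "\<Delta> \<subseteq> \<Sigma>" and "L \<subseteq> lists \<Delta>"
  shows "regular_language \<Delta> L"
proof -
  have "{w \<in> lists \<Delta>. map id w \<in> L} = L"
    using assms(3) by auto
  with regular_language_vimage[of \<Sigma> L \<Delta> id] assms regular_language_finite[OF assms(1)]
  show ?thesis
    by (simp add: finite_subset)
qed

text \<open>These words are the candidates for a single track of a two-track word. The amount of
  padding is left free because it depends on the other track, which cannot be seen from this
  one.\<close>

lemma regular_language_pad: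
  assumes "regular_language \<Sigma> L"
  shows "regular_language (insert None (Some ` \<Sigma>)) {map Some u @ replicate k None | u k. u \<in> L}"
proof -
  from assms obtain M :: "(nat, 'a) dfa" where M: "dfa_over \<Sigma> M" "L = dfa_language \<Sigma> M"
    unfolding regular_language_def by blast
  \<comment> \<open>\<open>Some None\<close> is reached after the first padding symbol, and \<open>None\<close> rejects.\<close>
  define step where "step = (\<lambda>q a. case q of None \<Rightarrow> None
      | Some None \<Rightarrow> (if a = None then Some None else None)
      | Some (Some p) \<Rightarrow> (case a of Some b \<Rightarrow> Some (Some (trans_fun M p b))
          | None \<Rightarrow> if p \<in> final M then Some None else None))"
  define F where "F = insert (Some None) (Some ` Some ` final M)"
  define N where "N = \<lparr>states = {None, Some None} \<union> Some ` Some ` states M,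
    init = Some (Some (init M)), trans_fun = step, final = F\<rparr>"
  have "dfa_over (insert None (Some ` \<Sigma>)) N"
    using M(1) by (auto simp: dfa_over_def N_def F_def step_def)
  \<comment> \<open>The next three facts compute what is accepted from each kind of state: nothing
    from \<open>None\<close>, pure padding from \<open>Some None\<close>, and from
    \<open>Some (Some q)\<close> a word that \<open>M\<close> accepts from \<open>q\<close>,
    followed by padding.\<close>
  moreover have dead: "foldl step None w = None" for w
    by (induction w) (auto simp: step_def)
  have padding: "foldl step (Some None) w \<in> F \<longleftrightarrow> (\<exists>k. w = replicate k None)" for w
  proof (induction w)
    case (Cons a w)
    show ?case
    proof (cases a)
      case None
      have "(\<exists>k. a # w = replicate k None) \<longleftrightarrow> (\<exists>k. w = replicate k None)"
        using None by (metis replicate_Suc length_Cons length_replicate list.inject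
            Suc_length_conv)
      with Cons None show ?thesis by (simp add: step_def)
    next
      case (Some b)
      then have "a # w \<noteq> replicate k None" for k
        by (cases k) auto
      with Some dead show ?thesis by (simp add: step_def F_def)
    qed
  qed (auto simp: F_def)
  have live: "foldl step (Some (Some q)) w \<in> F \<longleftrightarrow>
      (\<exists>u k. w = map Some u @ replicate k None \<and> foldl (trans_fun M) q u \<in> final M)" for q w
  proof (induction w arbitrary: q)
    case (Cons a w)
    show ?case
    proof (cases a)
      case None
      have "(\<exists>u k. a # w = map Some u @ replicate k None \<and> foldl (trans_fun M) q u \<in> final M)
          \<longleftrightarrow> q \<in> final M \<and> (\<exists>k. w = replicate k None)" (is "?l \<longleftrightarrow> ?r")
      proof
        assume ?l
        then obtain u k where u: "a # w = map Some u @ replicate k None"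
          "foldl (trans_fun M) q u \<in> final M" by blast
        with None have [simp]: "u = []" by (cases u) auto
        from u show ?r by (cases k) auto
      next
        assume ?r
        then obtain k where "q \<in> final M" "w = replicate k None" by blast
        with None show ?l by (intro exI[of _ "[]"] exI[of _ "Suc k"]) simp
      qed
      with None padding dead show ?thesis by (simp add: step_def F_def)
    next
      case (Some b)
      have "(\<exists>u k. a # w = map Some u @ replicate k None \<and> foldl (trans_fun M) q u \<in> final M)
          \<longleftrightarrow> (\<exists>u k. w = map Some u @ replicate k None \<and>
                foldl (trans_fun M) (trans_fun M q b) u \<in> final M)" (is "?l \<longleftrightarrow> ?r")
      proof
        assume ?l
        then obtain u k where u: "a # w = map Some u @ replicate k None"
          "foldl (trans_fun M) q u \<in> final M" by blast
        with Some obtain u' where "u = b # u'" by (cases u; cases k) auto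
        with u show ?r by auto
      next
        assume ?r
        then obtain u k where "w = map Some u @ replicate k None"
          "foldl (trans_fun M) (trans_fun M q b) u \<in> final M" by blast
        with Some show ?l by (intro exI[of _ "b # u"] exI[of _ k]) simp
      qed
      with Some Cons show ?thesis by (simp add: step_def)
    qed
  qed (auto simp: F_def)
  have "dfa_language (insert None (Some ` \<Sigma>)) N =
      {map Some u @ replicate k None | u k. u \<in> L}"
    using live by (fastforce simp: dfa_language_def M(2) N_def)
  ultimately show ?thesis
    using regular_languageI by metis
qed

section \<open>Words with two tracks\<close>

text \<open>A total form of indexing with the padding convention of \<open>convolution\<close>, so
  that words of different lengths can be compared position by position.\<close>

definition letter_at :: "'a list \<Rightarrow> nat \<Rightarrow> 'a option" where
  "letter_at w k = (if k < length w then Some (w ! k) else None)"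

text \<open>Past the end of both words there is no letter at all, hence \<open>None\<close> and not
  \<open>Some (None, None)\<close>. This makes \<open>letter_at_two_track\<close> hold at every
  position.\<close>

definition join_letters :: "'a option \<Rightarrow> 'b option \<Rightarrow> ('a option \<times> 'b option) option" where
  "join_letters a b = (if a = None \<and> b = None then None else Some (a, b))"

text \<open>The convolution of two words whose alphabets may have different types, with pairs
  instead of lists as letters.\<close>

definition two_track :: "'a list \<Rightarrow> 'b list \<Rightarrow> ('a option \<times> 'b option) list" where
  "two_track u v = map (\<lambda>k. (letter_at u k, letter_at v k)) [0..<max (length u) (length v)]"

text \<open>The pair \<open>(None, None)\<close> is excluded since it could only stand past the end
  of both words. Its absence fixes the amount of padding on the tracks.\<close>

definition two_track_alphabet :: "'a set \<Rightarrow> 'b set \<Rightarrow> ('a option \<times> 'b option) set" where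
  "two_track_alphabet \<Sigma> \<Gamma> =
     insert None (Some ` \<Sigma>) \<times> insert None (Some ` \<Gamma>) - {(None, None)}"

text \<open>The lengths agree as well, because \<open>letter_at\<close> yields \<open>None\<close>
  exactly from the end of the word on.\<close>

lemma letter_at_ext: "(\<And>k. letter_at u k = letter_at v k) \<Longrightarrow> u = v"
proof (rule nth_equalityI)
  assume eq: "\<And>k. letter_at u k = letter_at v k"
  have "k < length u \<longleftrightarrow> k < length v" for k
    using eq[of k] by (auto simp: letter_at_def split: if_splits)
  then show "length u = length v"
    by (meson linorder_neqE_nat less_irrefl)
  then show "u ! k = v ! k" if "k < length u" for k
    using eq[of k] that by (simp add: letter_at_def)
qed

lemma letter_at_in: "w \<in> lists \<Sigma> \<Longrightarrow> letter_at w k \<in> insert None (Some ` \<Sigma>)"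
  by (auto simp: letter_at_def)

lemma letter_at_eq_None_iff: "letter_at w k = None \<longleftrightarrow> length w \<le> k"
  by (simp add: letter_at_def)

lemma letter_at_beyond: "length w \<le> k \<Longrightarrow> letter_at w k = None"
  by (simp add: letter_at_def)

lemma length_two_track: "length (two_track u v) = max (length u) (length v)"
  by (simp add: two_track_def)

lemma letter_at_two_track:
  "letter_at (two_track u v) k = join_letters (letter_at u k) (letter_at v k)"
  by (auto simp: two_track_def join_letters_def letter_at_def)

lemma join_letters_inject: "join_letters a b = join_letters c d \<longleftrightarrow> a = c \<and> b = d"
  by (auto simp: join_letters_def)

text \<open>Since \<open>join_letters\<close> is injective, each position, including those past the
  end, gives back the letters of both tracks.\<close>

lemma two_track_inject: "two_track u v = two_track u' v' \<longleftrightarrow> u = u' \<and> v = v'"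
proof
  assume "two_track u v = two_track u' v'"
  then have "letter_at u k = letter_at u' k \<and> letter_at v k = letter_at v' k" for k
    using letter_at_two_track[of u v k] letter_at_two_track[of u' v' k]
    by (simp add: join_letters_inject)
  then show "u = u' \<and> v = v'"
    by (blast intro: letter_at_ext)
qed simp

lemma finite_two_track_alphabet:
  "finite \<Sigma> \<Longrightarrow> finite \<Gamma> \<Longrightarrow> finite (two_track_alphabet \<Sigma> \<Gamma>)"
  by (simp add: two_track_alphabet_def)

lemma two_track_in_lists:
  assumes "u \<in> lists \<Sigma>" and "v \<in> lists \<Gamma>"
  shows "two_track u v \<in> lists (two_track_alphabet \<Sigma> \<Gamma>)"
proof -
  have "(letter_at u k, letter_at v k) \<in> two_track_alphabet \<Sigma> \<Gamma>"
    if "k < max (length u) (length v)" for k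
    using that letter_at_in[OF assms(1), of k] letter_at_in[OF assms(2), of k]
    by (auto simp: two_track_alphabet_def letter_at_eq_None_iff simp del: insert_iff)
  then show ?thesis
    by (auto simp: two_track_def)
qed

text \<open>Truncated subtraction makes the padding empty when \<open>u\<close> is at least as long
  as \<open>v\<close>.\<close>

lemma map_fst_two_track:
  "map fst (two_track u v) = map Some u @ replicate (length v - length u) None"
  by (rule nth_equalityI) (auto simp: two_track_def letter_at_def nth_append)

lemma map_snd_two_track:
  "map snd (two_track u v) = map Some v @ replicate (length u - length v) None"
  by (rule nth_equalityI) (auto simp: two_track_def letter_at_def nth_append)

text \<open>A converse to the two preceding lemmas. The values of \<open>k\<close> and
  \<open>l\<close> are arbitrary here; the absence of \<open>(None, None)\<close> forces one of them
  to be zero.\<close>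

lemma two_track_of_tracks:
  assumes w: "(None, None) \<notin> set w"
    and u: "map fst w = map Some u @ replicate k None"
    and v: "map snd w = map Some v @ replicate l None"
  shows "w = two_track u v"
proof -
  have len: "length w = length u + k" "length w = length v + l"
    using arg_cong[OF u, of length] arg_cong[OF v, of length] by simp_all
  have nth: "w ! i = (letter_at u i, letter_at v i)" if "i < length w" for i
  proof (rule prod_eqI)
    show "fst (w ! i) = fst (letter_at u i, letter_at v i)"
      using arg_cong[OF u, of "\<lambda>xs. xs ! i"] that len(1) by (auto simp: nth_append letter_at_def)
    show "snd (w ! i) = snd (letter_at u i, letter_at v i)"
      using arg_cong[OF v, of "\<lambda>xs. xs ! i"] that len(2) by (auto simp: nth_append letter_at_def)
  qed
  \<comment> \<open>If \<open>w\<close> were longer, both tracks would already be padding at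
    position \<open>max (length u) (length v)\<close>.\<close>
  have "length w \<le> max (length u) (length v)"
  proof (rule ccontr)
    assume "\<not> ?thesis"
    then have i: "max (length u) (length v) < length w" by (simp only: not_le)
    from nth[OF i] have "w ! max (length u) (length v) = (None, None)"
      by (simp add: letter_at_def)
    with w nth_mem[OF i] show False by simp
  qed
  with len have "length w = max (length u) (length v)" by simp
  with nth show ?thesis
    by (intro nth_equalityI) (auto simp: two_track_def)
qed

text \<open>Each track is checked separately by an inverse image under \<open>fst\<close> or
  \<open>snd\<close>, and the two conditions are intersected. The alphabet itself ensures that the
  padding on the two tracks fits together.\<close>

lemma regular_language_two_track:
  assumes K: "regular_language \<Sigma> K" and L: "regular_language \<Gamma> L"
  shows "regular_language (two_track_alphabet \<Sigma> \<Gamma>) {two_track u v | u v. u \<in> K \<and> v \<in> L}"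
proof -
  let ?\<Delta> = "two_track_alphabet \<Sigma> \<Gamma>"
  let ?pad = "\<lambda>L. {map Some u @ replicate k None | u k. u \<in> L}"
  have fin: "finite ?\<Delta>"
    using K L by (simp add: finite_two_track_alphabet regular_language_finite)
  have "regular_language ?\<Delta> ({w \<in> lists ?\<Delta>. map fst w \<in> ?pad K} \<inter>
      {w \<in> lists ?\<Delta>. map snd w \<in> ?pad L})"
    by (intro regular_language_Int
        regular_language_vimage[OF regular_language_pad[OF K] fin]
        regular_language_vimage[OF regular_language_pad[OF L] fin])
      (auto simp: two_track_alphabet_def)
  also have "{w \<in> lists ?\<Delta>. map fst w \<in> ?pad K} \<inter> {w \<in> lists ?\<Delta>. map snd w \<in> ?pad L} =
      {two_track u v | u v. u \<in> K \<and> v \<in> L}" (is "?l = ?r")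
  proof
    show "?l \<subseteq> ?r"
    proof
      fix w assume "w \<in> ?l"
      then obtain u k v l where "w \<in> lists ?\<Delta>" "u \<in> K" "v \<in> L"
        "map fst w = map Some u @ replicate k None" "map snd w = map Some v @ replicate l None"
        by blast
      moreover from this have "(None, None) \<notin> set w"
        by (auto simp: two_track_alphabet_def)
      ultimately show "w \<in> ?r"
        using two_track_of_tracks by blast
    qed
    show "?r \<subseteq> ?l"
    proof
      fix w assume "w \<in> ?r"
      then obtain u v where w: "w = two_track u v" "u \<in> K" "v \<in> L" by blast
      have "u \<in> lists \<Sigma>" "v \<in> lists \<Gamma>"
        using w regular_language_subset_lists[OF K] regular_language_subset_lists[OF L] by blast+
      then have "w \<in> lists ?\<Delta>"
        unfolding w(1) by (rule two_track_in_lists)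
      moreover have "map fst w \<in> ?pad K" "map snd w \<in> ?pad L"
        unfolding w(1) map_fst_two_track map_snd_two_track using w(2,3) by blast+
      ultimately show "w \<in> ?l" by simp
    qed
  qed
  finally show ?thesis .
qed

section \<open>Convolutions of words with two tracks\<close>

lemma convolution_pair:
  "convolution [u, v] =
     map (\<lambda>k. [letter_at u k, letter_at v k]) [0..<max (length u) (length v)]"
  by (simp add: convolution_def letter_at_def)

lemma letter_at_convolution_pair:
  "letter_at (convolution [u, v]) k =
     (if k < max (length u) (length v) then Some [letter_at u k, letter_at v k] else None)"
  by (simp add: convolution_pair letter_at_def)

lemma length_convolution_pair: "length (convolution [u, v]) = max (length u) (length v)"
  by (simp add: convolution_pair)

lemma padded_alphabet_two:
  "padded_alphabet 2 \<Sigma> = {[a, b] | a b. a \<in> insert None (Some ` \<Sigma>) \<and> b \<in> insert None (Some ` \<Sigma>)}"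
  by (auto simp: padded_alphabet_def length_Suc_conv numeral_2_eq_2)

lemma finite_padded_alphabet: "finite \<Sigma> \<Longrightarrow> finite (padded_alphabet n \<Sigma>)"
  using finite_lists_length_eq[of "insert None (Some ` \<Sigma>)" n]
  by (simp add: padded_alphabet_def conj_commute)

text \<open>At every position before the end of the longer word, at least one of the two words still
  has a letter.\<close>

lemma convolution_pair_in_lists:
  assumes "u \<in> lists \<Sigma>" and "v \<in> lists \<Sigma>"
  shows "convolution [u, v] \<in> lists (padded_alphabet 2 \<Sigma> - {[None, None]})"
proof -
  have "[letter_at u k, letter_at v k] \<in> padded_alphabet 2 \<Sigma> - {[None, None]}"
    if "k < max (length u) (length v)" for k
    using that letter_at_in[OF assms(1), of k] letter_at_in[OF assms(2), of k]
    by (auto simp: padded_alphabet_two letter_at_eq_None_iff simp del: insert_iff)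
  then show ?thesis
    by (simp only: convolution_pair in_lists_conv_set set_map set_upt) force
qed

text \<open>The value \<open>None\<close> of \<open>s\<close> stands for a position past the end of
  a convolution, where both convolved words have ended, so either component is padding.\<close>

definition component :: "'a option list option \<Rightarrow> nat \<Rightarrow> 'a option" where
  "component s i = (case s of None \<Rightarrow> None | Some l \<Rightarrow> l ! i)"

text \<open>Four letters form a 2 by 2 array whose rows are the letters of two convolutions.
  Transposing it pairs the first components with each other and the second components with each
  other.\<close>

definition transpose_letter ::
  "'a option list option \<times> 'b option list option \<Rightarrow> ('a option \<times> 'b option) option list" where
  "transpose_letter = (\<lambda>(s, t).
     [join_letters (component s 0) (component t 0), join_letters (component s 1) (component t 1)])"

text \<open>Both sides have the maximum of the four lengths as their length, and at position
  \<open>k\<close> both are assembled from the \<open>k\<close>-th letters of the same four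
  words.\<close>

lemma convolution_two_track:
  "convolution [two_track u v, two_track u' v'] =
     map transpose_letter (two_track (convolution [u, u']) (convolution [v, v']))"
proof -
  \<comment> \<open>This holds past the end of the convolution too, where both sides are
    \<open>None\<close>.\<close>
  have comp: "component (letter_at (convolution [u, u']) k) 0 = letter_at u k"
    "component (letter_at (convolution [u, u']) k) 1 = letter_at u' k"
    for u u' :: "'x list" and k
    by (simp_all add: component_def letter_at_convolution_pair letter_at_beyond)
  show ?thesis
    unfolding convolution_pair[of "two_track u v"]
    unfolding two_track_def[of "convolution [u, u']"]
    unfolding length_two_track length_convolution_pair letter_at_two_track map_map o_def
    by (simp add: transpose_letter_def comp[unfolded One_nat_def] ac_simps)
qed

text \<open>The only letter whose components coincide with those of the padding symbol
  \<open>None\<close> is \<open>Some [None, None]\<close>, so removing \<open>[None, None]\<close>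
  from both alphabets makes the four components determine the letter.\<close>

lemma inj_on_transpose_letter:
  "inj_on transpose_letter
     (two_track_alphabet (padded_alphabet 2 \<Sigma> - {[None, None]})
       (padded_alphabet 2 \<Gamma> - {[None, None]}))"
proof -
  have *: "s = t" if "component s 0 = component t 0" "component s 1 = component t 1"
    "s \<in> insert None (Some ` (padded_alphabet 2 \<Sigma> - {[None, None]}))"
    "t \<in> insert None (Some ` (padded_alphabet 2 \<Sigma> - {[None, None]}))"
    for s t and \<Sigma> :: "'x set"
    using that by (auto simp: component_def padded_alphabet_two)
  show ?thesis
  proof (rule inj_onI, clarify)
    fix s s' t t'
    assume mem: "(s, s') \<in> two_track_alphabet (padded_alphabet 2 \<Sigma> - {[None, None]})
        (padded_alphabet 2 \<Gamma> - {[None, None]})"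
      "(t, t') \<in> two_track_alphabet (padded_alphabet 2 \<Sigma> - {[None, None]})
        (padded_alphabet 2 \<Gamma> - {[None, None]})"
      and "transpose_letter (s, s') = transpose_letter (t, t')"
    then have comp: "component s 0 = component t 0" "component s 1 = component t 1"
      "component s' 0 = component t' 0" "component s' 1 = component t' 1"
      by (simp_all add: transpose_letter_def join_letters_inject)
    from mem show "s = t \<and> s' = t'"
      unfolding two_track_alphabet_def Diff_iff mem_Sigma_iff
      using *[OF comp(1,2)] *[OF comp(3,4)] by blast
  qed
qed

text \<open>Two padding symbols are joined to \<open>None\<close>, so the excluded pair
  \<open>(None, None)\<close> never arises as a letter. The inclusion allows the recoded language to
  be moved to the full padded alphabet.\<close>

lemma transpose_letter_image:
  "transpose_letter ` two_track_alphabet (padded_alphabet 2 \<Sigma> - {[None, None]})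
       (padded_alphabet 2 \<Gamma> - {[None, None]})
     \<subseteq> padded_alphabet 2 (two_track_alphabet \<Sigma> \<Gamma>)"
proof -
  have comp: "component s i \<in> insert None (Some ` \<Sigma>)"
    if "s \<in> insert None (Some ` (padded_alphabet 2 \<Sigma> - {[None, None]}))" "i < 2"
    for s i and \<Sigma> :: "'x set"
    using that by (auto simp: component_def padded_alphabet_two less_2_cases_iff)
  have join: "join_letters a b \<in> insert None (Some ` two_track_alphabet \<Sigma> \<Gamma>)"
    if "a \<in> insert None (Some ` \<Sigma>)" "b \<in> insert None (Some ` \<Gamma>)" for a b
    using that by (auto simp: join_letters_def two_track_alphabet_def)
  show ?thesis
  proof (rule image_subsetI)
    fix p
    assume p: "p \<in> two_track_alphabet (padded_alphabet 2 \<Sigma> - {[None, None]})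
       (padded_alphabet 2 \<Gamma> - {[None, None]})"
    obtain s t where [simp]: "p = (s, t)" by fastforce
    have s: "s \<in> insert None (Some ` (padded_alphabet 2 \<Sigma> - {[None, None]}))"
      and t: "t \<in> insert None (Some ` (padded_alphabet 2 \<Gamma> - {[None, None]}))"
      using p by (simp_all only: two_track_alphabet_def \<open>p = (s, t)\<close> Diff_iff mem_Sigma_iff)
    have "join_letters (component s i) (component t i)
        \<in> insert None (Some ` two_track_alphabet \<Sigma> \<Gamma>)" if "i < 2" for i
      using that by (intro join comp s t)
    from this[of 0] this[of 1]
    show "transpose_letter p \<in> padded_alphabet 2 (two_track_alphabet \<Sigma> \<Gamma>)"
      by (simp add: padded_alphabet_two transpose_letter_def)
  qed
qed

section \<open>Recognizable binary relations: pairing on two tracks, and the diagonal\<close>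

lemma FA_recognizable_pair_lists:
  assumes "FA_recognizable 2 \<Sigma> T" and "[u, v] \<in> T"
  shows "u \<in> lists \<Sigma>" and "v \<in> lists \<Sigma>"
proof -
  have "set [u, v] \<subseteq> lists \<Sigma>"
    using assms unfolding FA_recognizable_def by blast
  then show "u \<in> lists \<Sigma>" and "v \<in> lists \<Sigma>"
    by simp_all
qed

text \<open>Passing to the alphabet without \<open>[None, None]\<close> prepares for the recoding by
  \<open>transpose_letter\<close>, which is injective there.\<close>

lemma regular_language_convolution_pairs:
  assumes T: "FA_recognizable 2 \<Sigma> T"
  shows "regular_language (padded_alphabet 2 \<Sigma> - {[None, None]}) (convolution ` T)"
proof (rule regular_language_restrict)
  show "regular_language (padded_alphabet 2 \<Sigma>) (convolution ` T)"
    using T by (simp add: FA_recognizable_def)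
  show "convolution ` T \<subseteq> lists (padded_alphabet 2 \<Sigma> - {[None, None]})"
  proof (rule image_subsetI)
    fix ws assume ws: "ws \<in> T"
    then have "length ws = 2"
      using T by (auto simp only: FA_recognizable_def)
    then obtain u v where "ws = [u, v]"
      by (auto simp: numeral_2_eq_2 length_Suc_conv)
    with ws show "convolution ws \<in> lists (padded_alphabet 2 \<Sigma> - {[None, None]})"
      using convolution_pair_in_lists[OF FA_recognizable_pair_lists[OF T]] by simp
  qed
qed blast

text \<open>By \<open>convolution_two_track\<close>, the language in question is the image under
  \<open>transpose_letter\<close> of the two-track language built from the two convolution
  languages. An injective recoding of letters preserves regularity, and afterwards the alphabet is
  enlarged.\<close>

lemma FA_recognizable_two_track:
  assumes E: "FA_recognizable 2 \<Sigma> {[u, u'] | u u'. E u u'}"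
    and F: "FA_recognizable 2 \<Gamma> {[v, v'] | v v'. F v v'}"
    and fin: "finite \<Sigma>" "finite \<Gamma>"
  shows "FA_recognizable 2 (two_track_alphabet \<Sigma> \<Gamma>)
    {[two_track u v, two_track u' v'] | u u' v v'. E u u' \<and> F v v'}"
proof -
  let ?S = "{[u, u'] | u u'. E u u'}" and ?T = "{[v, v'] | v v'. F v v'}"
  let ?R = "{[two_track u v, two_track u' v'] | u u' v v'. E u u' \<and> F v v'}"
  have E_lists: "u \<in> lists \<Sigma>" "u' \<in> lists \<Sigma>" if "E u u'" for u u'
    using FA_recognizable_pair_lists[OF E, of u u'] that by simp_all
  have F_lists: "v \<in> lists \<Gamma>" "v' \<in> lists \<Gamma>" if "F v v'" for v v'
    using FA_recognizable_pair_lists[OF F, of v v'] that by simp_all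
  have "regular_language (padded_alphabet 2 \<Sigma> - {[None, None]}) (convolution ` ?S)"
    using E by (rule regular_language_convolution_pairs)
  moreover have "regular_language (padded_alphabet 2 \<Gamma> - {[None, None]}) (convolution ` ?T)"
    using F by (rule regular_language_convolution_pairs)
  ultimately have "regular_language
      (transpose_letter ` two_track_alphabet (padded_alphabet 2 \<Sigma> - {[None, None]})
        (padded_alphabet 2 \<Gamma> - {[None, None]}))
      (map transpose_letter `
        {two_track x y | x y. x \<in> convolution ` ?S \<and> y \<in> convolution ` ?T})"
    by (rule regular_language_map[OF regular_language_two_track inj_on_transpose_letter])
  then have "regular_language (padded_alphabet 2 (two_track_alphabet \<Sigma> \<Gamma>))
      (map transpose_letter `
        {two_track x y | x y. x \<in> convolution ` ?S \<and> y \<in> convolution ` ?T})"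
    by (rule regular_language_mono[OF _ transpose_letter_image])
      (intro finite_padded_alphabet finite_two_track_alphabet fin)
  also have "map transpose_letter `
      {two_track x y | x y. x \<in> convolution ` ?S \<and> y \<in> convolution ` ?T} = convolution ` ?R"
    (is "?l = ?r")
  proof
    show "?l \<subseteq> ?r"
    proof
      fix w assume "w \<in> ?l"
      then obtain u u' v v' where uv: "E u u'" "F v v'"
        "w = map transpose_letter (two_track (convolution [u, u']) (convolution [v, v']))"
        by blast
      then have "w = convolution [two_track u v, two_track u' v']"
        by (simp only: convolution_two_track)
      with uv(1,2) show "w \<in> ?r" by blast
    qed
    show "?r \<subseteq> ?l"
    proof
      fix w assume "w \<in> ?r"
      then obtain u u' v v' where uv: "E u u'" "F v v'"
        "w = convolution [two_track u v, two_track u' v']"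
        by blast
      then have "w = map transpose_letter (two_track (convolution [u, u']) (convolution [v, v']))"
        by (simp only: convolution_two_track)
      with uv(1,2) show "w \<in> ?l" by blast
    qed
  qed
  finally have "regular_language (padded_alphabet 2 (two_track_alphabet \<Sigma> \<Gamma>)) (convolution ` ?R)" .
  moreover have "?R \<subseteq> {ws. length ws = 2 \<and> set ws \<subseteq> lists (two_track_alphabet \<Sigma> \<Gamma>)}"
  proof
    fix ws assume "ws \<in> ?R"
    then obtain u u' v v' where ws: "E u u'" "F v v'" "ws = [two_track u v, two_track u' v']"
      by blast
    with E_lists[OF ws(1)] F_lists[OF ws(2)]
    show "ws \<in> {ws. length ws = 2 \<and> set ws \<subseteq> lists (two_track_alphabet \<Sigma> \<Gamma>)}"
      by (simp add: two_track_in_lists del: in_lists_conv_set)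
  qed
  ultimately show ?thesis
    unfolding FA_recognizable_def by blast
qed

text \<open>Convolving a word with itself needs no padding and merely doubles each letter, which is
  an injective recoding.\<close>

lemma FA_recognizable_diagonal:
  assumes R: "regular_language \<Sigma> R"
  shows "FA_recognizable 2 \<Sigma> {[u, u] | u. u \<in> R}"
proof -
  let ?d = "\<lambda>a. [Some a, Some a]"
  have "convolution [u, u] = map ?d u" for u :: "'a list"
    by (rule nth_equalityI) (auto simp: convolution_pair letter_at_def)
  then have "convolution ` {[u, u] | u. u \<in> R} = map ?d ` R"
    by (auto simp: image_iff) metis
  moreover have "regular_language (?d ` \<Sigma>) (map ?d ` R)"
    by (rule regular_language_map[OF R]) (simp add: inj_on_def)
  then have "regular_language (padded_alphabet 2 \<Sigma>) (map ?d ` R)"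
    by (rule regular_language_mono[OF _ _ finite_padded_alphabet[OF regular_language_finite[OF R]]])
      (auto simp: padded_alphabet_two)
  ultimately show ?thesis
    using regular_language_subset_lists[OF R] by (auto simp: FA_recognizable_def)
qed

section \<open>Direct products\<close>

text \<open>The identity labels exactly the loops of the Cayley graph, and since
  \<open>\<nu>\<close> is injective, these correspond to the pairs of equal normal forms.\<close>

lemma FA_presentation_insert_one:
  assumes "group G" and P: "FA_presentation \<Sigma> R \<nu> G X"
  shows "FA_presentation \<Sigma> R \<nu> G (insert \<one>\<^bsub>G\<^esub> X)"
proof -
  interpret group G by fact
  from P have bij: "bij_betw \<nu> R (carrier G)" and R: "regular_language \<Sigma> R"
    by (auto simp: FA_presentation_def)
  have "(\<nu> u, \<nu> v) \<in> cayley_edges G \<one>\<^bsub>G\<^esub> \<longleftrightarrow> u = v" if "u \<in> R" "v \<in> R" for u v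
  proof -
    have "\<nu> u \<in> carrier G" "\<nu> u = \<nu> v \<longleftrightarrow> u = v"
      using that bij by (auto simp: bij_betw_def inj_on_def)
    then show ?thesis by (auto simp: cayley_edges_def)
  qed
  then have "{[u, v] | u v. u \<in> R \<and> v \<in> R \<and> (\<nu> u, \<nu> v) \<in> cayley_edges G \<one>\<^bsub>G\<^esub>} =
      {[u, u] | u. u \<in> R}"
    by blast
  with P FA_recognizable_diagonal[OF R] show ?thesis
    by (simp add: FA_presentation_def)
qed

lemma cayley_edges_DirProd:
  "((a, b), (a', b')) \<in> cayley_edges (A \<times>\<times> B) (x, y) \<longleftrightarrow>
     (a, a') \<in> cayley_edges A x \<and> (b, b') \<in> cayley_edges B y"
  by (auto simp: cayley_edges_def)

lemma FA_presentation_DirProd: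
  assumes A: "FA_presentation \<Sigma> R \<nu> A X" and B: "FA_presentation \<Gamma> S \<mu> B Y"
  shows "\<exists>\<kappa>. FA_presentation (two_track_alphabet \<Sigma> \<Gamma>)
    {two_track u v | u v. u \<in> R \<and> v \<in> S} \<kappa> (A \<times>\<times> B) (X \<times> Y)"
proof -
  let ?T = "{two_track u v | u v. u \<in> R \<and> v \<in> S}"
  from A B have fin: "finite \<Sigma>" "finite \<Gamma>" and reg: "regular_language \<Sigma> R" "regular_language \<Gamma> S"
    and bij: "bij_betw \<nu> R (carrier A)" "bij_betw \<mu> S (carrier B)"
    by (auto simp: FA_presentation_def)
  have T: "?T = (\<lambda>(u, v). two_track u v) ` (R \<times> S)"
    by auto
  have inj: "inj_on (\<lambda>(u, v). two_track u v) (R \<times> S)"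
    by (auto simp: inj_on_def two_track_inject)
  \<comment> \<open>The new naming map splits a two-track word into its tracks and applies
    \<open>\<nu>\<close> and \<open>\<mu>\<close> to them.\<close>
  define \<kappa> where "\<kappa> = map_prod \<nu> \<mu> \<circ> the_inv_into (R \<times> S) (\<lambda>(u, v). two_track u v)"
  have \<kappa>: "\<kappa> (two_track u v) = (\<nu> u, \<mu> v)" if "u \<in> R" "v \<in> S" for u v
    using that the_inv_into_f_f[OF inj, of "(u, v)"] by (simp add: \<kappa>_def)
  have "bij_betw \<kappa> ?T (carrier A \<times> carrier B)"
    unfolding \<kappa>_def T
    by (intro bij_betw_trans[OF bij_betw_the_inv_into] inj_on_imp_bij_betw inj
        bij_betw_map_prod bij)
  moreover have "FA_recognizable 2 (two_track_alphabet \<Sigma> \<Gamma>)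
      {[p, q] | p q. p \<in> ?T \<and> q \<in> ?T \<and> (\<kappa> p, \<kappa> q) \<in> cayley_edges (A \<times>\<times> B) (x, y)}"
    if "x \<in> X" "y \<in> Y" for x y
  proof -
    let ?E = "\<lambda>u u'. u \<in> R \<and> u' \<in> R \<and> (\<nu> u, \<nu> u') \<in> cayley_edges A x"
    let ?F = "\<lambda>v v'. v \<in> S \<and> v' \<in> S \<and> (\<mu> v, \<mu> v') \<in> cayley_edges B y"
    have "FA_recognizable 2 \<Sigma> {[u, u'] | u u'. ?E u u'}"
      "FA_recognizable 2 \<Gamma> {[v, v'] | v v'. ?F v v'}"
      using A B that by (simp_all add: FA_presentation_def)
    then have "FA_recognizable 2 (two_track_alphabet \<Sigma> \<Gamma>)
        {[two_track u v, two_track u' v'] | u u' v v'. ?E u u' \<and> ?F v v'}"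
      using fin by (rule FA_recognizable_two_track)
    also have "{[two_track u v, two_track u' v'] | u u' v v'. ?E u u' \<and> ?F v v'} =
      {[p, q] | p q. p \<in> ?T \<and> q \<in> ?T \<and> (\<kappa> p, \<kappa> q) \<in> cayley_edges (A \<times>\<times> B) (x, y)}"
      (is "?l = ?r")
    proof
      show "?l \<subseteq> ?r"
      proof
        fix w assume "w \<in> ?l"
        then obtain u u' v v' where w: "?E u u'" "?F v v'" "w = [two_track u v, two_track u' v']"
          by blast
        then have "(\<kappa> (two_track u v), \<kappa> (two_track u' v')) \<in> cayley_edges (A \<times>\<times> B) (x, y)"
          by (simp add: \<kappa> cayley_edges_DirProd)
        with w show "w \<in> ?r" by blast
      qed
      show "?r \<subseteq> ?l"
      proof
        fix w assume "w \<in> ?r"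
        then obtain u u' v v' where w: "u \<in> R" "u' \<in> R" "v \<in> S" "v' \<in> S"
          "w = [two_track u v, two_track u' v']"
          "(\<kappa> (two_track u v), \<kappa> (two_track u' v')) \<in> cayley_edges (A \<times>\<times> B) (x, y)"
          by blast
        then have "?E u u'" "?F v v'"
          by (simp_all add: \<kappa> cayley_edges_DirProd)
        with w(5) show "w \<in> ?l" by blast
      qed
    qed
    finally show ?thesis .
  qed
  ultimately have "FA_presentation (two_track_alphabet \<Sigma> \<Gamma>) ?T \<kappa> (A \<times>\<times> B) (X \<times> Y)"
    using fin reg finite_two_track_alphabet regular_language_two_track
    unfolding FA_presentation_def by (auto simp only: carrier_DirProd simp: mem_Times_iff)
  then show ?thesis by (intro exI)
qed

text \<open>With both identities available, \<open>X \<times> Y\<close> contains a copy of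
  \<open>X\<close> on the first axis and a copy of \<open>Y\<close> on the second, and the two axes
  generate the product.\<close>

lemma generate_DirProd:
  assumes "group A" "group B"
    and X: "X \<subseteq> carrier A" "\<one>\<^bsub>A\<^esub> \<in> X" "generate A X = carrier A"
    and Y: "Y \<subseteq> carrier B" "\<one>\<^bsub>B\<^esub> \<in> Y" "generate B Y = carrier B"
  shows "generate (A \<times>\<times> B) (X \<times> Y) = carrier (A \<times>\<times> B)"
proof
  interpret A: group A by fact
  interpret B: group B by fact
  interpret AB: group "A \<times>\<times> B" by (rule DirProd_group) fact+
  let ?H = "generate (A \<times>\<times> B) (X \<times> Y)"
  show "?H \<subseteq> carrier (A \<times>\<times> B)"
    using X(1) Y(1) by (intro AB.generate_incl) auto
  have fst: "(a, \<one>\<^bsub>B\<^esub>) \<in> ?H" if "a \<in> generate A X" for a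
    using that
  proof induction
    case one
    show ?case using generate.one[of "A \<times>\<times> B"] by simp
  next
    case (incl h)
    with Y(2) show ?case by (intro generate.incl) simp
  next
    case (inv h)
    then have "inv\<^bsub>A \<times>\<times> B\<^esub> (h, \<one>\<^bsub>B\<^esub>) \<in> ?H" using Y(2) by (intro generate.inv) simp
    with inv X(1) show ?case by (simp add: subset_iff inv_DirProd[OF assms(1,2)])
  next
    case (eng h k)
    then show ?case using generate.eng[OF eng.IH] by simp
  qed
  have snd: "(\<one>\<^bsub>A\<^esub>, b) \<in> ?H" if "b \<in> generate B Y" for b
    using that
  proof induction
    case one
    show ?case using generate.one[of "A \<times>\<times> B"] by simp
  next
    case (incl h)
    with X(2) show ?case by (intro generate.incl) simp
  next
    case (inv h)
    then have "inv\<^bsub>A \<times>\<times> B\<^esub> (\<one>\<^bsub>A\<^esub>, h) \<in> ?H" using X(2) by (intro generate.inv) simp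
    with inv Y(1) show ?case by (simp add: subset_iff inv_DirProd[OF assms(1,2)])
  next
    case (eng h k)
    then show ?case using generate.eng[OF eng.IH] by simp
  qed
  show "carrier (A \<times>\<times> B) \<subseteq> ?H"
  proof
    fix p assume "p \<in> carrier (A \<times>\<times> B)"
    then obtain a b where p: "p = (a, b)" "a \<in> carrier A" "b \<in> carrier B" by auto
    \<comment> \<open>The pair \<open>(a, b)\<close> is the product of its projections
      \<open>(a, \<one>)\<close> and \<open>(\<one>, b)\<close> to the axes.\<close>
    with X(3) Y(3) show "p \<in> ?H"
      using generate.eng[OF fst[of a] snd[of b]] by simp
  qed
qed

theorem corollary10p4:
  fixes A :: "('a, 'm) monoid_scheme" and B :: "('b, 'n) monoid_scheme"
  assumes "graph_automatic A" and "graph_automatic B"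
  shows "graph_automatic (A \<times>\<times> B)"
proof -
  from assms(1) obtain X and \<Sigma> :: "nat set" and R \<nu>
    where A: "group A" "finite X" "X \<subseteq> carrier A" "generate A X = carrier A"
      "FA_presentation \<Sigma> R \<nu> A X"
    unfolding graph_automatic_def graph_automatic_wrt_def by blast
  from assms(2) obtain Y and \<Gamma> :: "nat set" and S \<mu>
    where B: "group B" "finite Y" "Y \<subseteq> carrier B" "generate B Y = carrier B"
      "FA_presentation \<Gamma> S \<mu> B Y"
    unfolding graph_automatic_def graph_automatic_wrt_def by blast
  interpret A: group A by fact
  interpret B: group B by fact
  \<comment> \<open>The product of the original generating sets may generate too little: for two
    copies of the integers, each generated by 1, it yields only the diagonal.\<close>
  define X' where "X' = insert \<one>\<^bsub>A\<^esub> X"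
  define Y' where "Y' = insert \<one>\<^bsub>B\<^esub> Y"
  have X': "finite X'" "X' \<subseteq> carrier A" "\<one>\<^bsub>A\<^esub> \<in> X'"
    using A by (auto simp: X'_def)
  have Y': "finite Y'" "Y' \<subseteq> carrier B" "\<one>\<^bsub>B\<^esub> \<in> Y'"
    using B by (auto simp: Y'_def)
  have "generate A X' = carrier A"
    using A.mono_generate[of X X'] A.generate_incl[OF X'(2)] A(4) by (auto simp: X'_def)
  moreover have "generate B Y' = carrier B"
    using B.mono_generate[of Y Y'] B.generate_incl[OF Y'(2)] B(4) by (auto simp: Y'_def)
  ultimately have gen: "generate (A \<times>\<times> B) (X' \<times> Y') = carrier (A \<times>\<times> B)"
    using A(1) B(1) X' Y' by (intro generate_DirProd)
  obtain \<kappa> where "FA_presentation (two_track_alphabet \<Sigma> \<Gamma>)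
      {two_track u v | u v. u \<in> R \<and> v \<in> S} \<kappa> (A \<times>\<times> B) (X' \<times> Y')"
    using FA_presentation_DirProd[OF FA_presentation_insert_one[OF A(1,5)]
        FA_presentation_insert_one[OF B(1,5)]]
    unfolding X'_def Y'_def by blast
  \<comment> \<open>The letters of this presentation are pairs of optional numbers;
    \<open>graph_automatic_wrtI\<close> recodes them as numbers.\<close>
  then have "graph_automatic_wrt (A \<times>\<times> B) (X' \<times> Y')"
    using DirProd_group[OF A(1) B(1)] X' Y' gen by (intro graph_automatic_wrtI) auto
  then show ?thesis
    unfolding graph_automatic_def by blast
qed

end
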